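(* Consider the problem $\min_{x\in\operatorname{dom}\Psi}[\tilde f(x)=f(x)+\Psi(x)]$, where $f$ is convex with $\operatorname{dom} f=\mathbb{E}$ and satisfies the Regularity Assumption, and $\Psi$ is a closed convex function; let $x^*$ be an optimal solution. Let the sequences $\{x_k\}$, $\{L_k\}$ be generated by the method PGM (described in the context) with accuracy $\epsilon>0$ and $0<L_0\le\gamma_f(\epsilon)$. Denote $$S_k=\sum_{i=0}^k\frac1{L_{i+1}},\qquad \tilde f_k^*=\frac1{S_k}\sum_{i=0}^k\frac1{L_{i+1}}\tilde f(x_{i+1}).$$ Then for all $k\ge0$ we have $L_k\le\gamma_f(\epsilon)$. Moreover, for all $k\ge 0$ and all $y\in\operatorname{dom}\Psi$, $$\tilde f_k^*\ \le\ \frac1{S_k}\sum_{i=0}^k\frac1{L_{i+1}}\big[f(x_i)+\langle\nabla f(x_i),y-x_i\rangle\big]+\Psi(y)+\frac\epsilon2+\frac2{S_k}\,\beta_d(x_0,y).$$ Therefore, for all $k\ge 0$, $$\tilde f_k^*-\tilde f(x^* )\ \le\ \frac\epsilon2+\frac{2}{k+1}\,\gamma_f(\epsilon)\,\beta_d(x_0,x^* ).$$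
   Context: $\mathbb{E}$ is a finite-dimensional real linear space with dual $\mathbb{E}^*$; $\langle g,x\rangle$ is the value of $g\in\mathbb{E}^*$ at $x$; $\|\cdot\|$ is an arbitrary fixed norm on $\mathbb{E}$. $f:\mathbb{E}\to\mathbb{R}$ is convex and not affine; $\nabla f(x)\in\partial f(x)$ is its gradient (subgradient). $\Psi$ is closed convex with $\operatorname{dom}\Psi\subseteq\mathbb{E}$, $\operatorname{int}(\operatorname{dom}\Psi)\ne\emptyset$. Global Curvature Bound: $\hat\mu(t)=\sup\big\{\frac{\alpha f(x)+(1-\alpha)f(y)-f(\alpha x+(1-\alpha)y)}{\alpha(1-\alpha)}:\ x,y\in\mathbb{E},\ \alpha\in(0,1),\ \|x-y\|\le t\big\}$, $t\ge0$. Regularity Assumption: $\hat\mu(t)<+\infty$ for all $t\ge0$ and $\lim_{\tau\to+0}\frac1\tau\hat\mu(\tau)=0$. The complexity gauge $s_f$ is the inverse function of $\hat\mu$: $\hat\mu(s_f(\epsilon))=\epsilon$, $\epsilon\ge0$. For $t>0$: $\gamma_f(t)=t/s_f^2(t/2)$. Prox-function: $d$ is a differentiable convex function on $\operatorname{dom}\Psi$ with $d(y)\ge d(x)+\langle\nabla d(x),y-x\rangle+\frac12\|y-x\|^2$ for $x\in\operatorname{int}(\operatorname{dom}\Psi)$, $y\in\operatorname{dom}\Psi$; $x_0=\operatorname{arg\,min}_{x\in\operatorname{dom}\Psi}d(x)$ and $d(x_0)=0$. Bregman distance: $\beta_d(x,y)=d(y)-d(x)-\langle\nabla d(x),y-x\rangle$.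 Bregman mapping: $\mathcal{B}_M(x)=\operatorname{arg\,min}_{y\in\operatorname{dom}\Psi}\{f(x)+\langle\nabla f(x),y-x\rangle+M\beta_d(x,y)+\Psi(y)\}$, assumed to be computable. Universal Primal Gradient Method (PGM). Start from $x_0$ above; choose $L_0>0$ and $\epsilon>0$. For $k\ge0$ do: 1. Find the smallest integer $i_k\ge0$ such that for $x_k^+=\mathcal{B}_{2^{i_k}L_k}(x_k)$ we have $f(x_k^+)\le f(x_k)+\langle\nabla f(x_k),x_k^+-x_k\rangle+2^{i_k-1}L_k\|x_k^+-x_k\|^2+\frac\epsilon2$. 2. Set $x_{k+1}=\mathcal{B}_{2^{i_k}L_k}(x_k)$ and $L_{k+1}=2^{i_k-1}L_k$. *)

theory Defs
  imports "HOL-Analysis.Analysis"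
begin

text \<open>
  The space is a type of class \<^class>\<open>real_normed_vector\<close>, so the norm is an arbitrary one; the
  theorem adds that the type has a finite spanning set. In finite dimension every linear functional
  is bounded, hence the dual space is \<^typ>\<open>'a \<Rightarrow>\<^sub>L real\<close>.

  A closed convex function \<open>\<Psi>\<close> is given by its domain \<open>Q\<close> together with its finite values on \<open>Q\<close>
  (values outside \<open>Q\<close> are never used); it is closed if its epigraph over \<open>Q\<close> is closed in the
  product of the whole space and the reals. The set \<open>Q\<close> itself need not be closed.
\<close>

definition closed_convex_fun :: "'a::real_normed_vector set \<Rightarrow> ('a \<Rightarrow> real) \<Rightarrow> bool" where
  "closed_convex_fun Q \<Psi> \<longleftrightarrow> convex_on Q \<Psi> \<and> closed (epigraph Q \<Psi>)"

definition affine_fun :: "('a::real_normed_vector \<Rightarrow> real) \<Rightarrow> bool" where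
  "affine_fun f \<longleftrightarrow> (\<exists>(g :: 'a \<Rightarrow>\<^sub>L real) c. \<forall>x. f x = blinfun_apply g x + c)"

definition subdifferential ::
    "('a::real_normed_vector \<Rightarrow> real) \<Rightarrow> 'a \<Rightarrow> ('a \<Rightarrow>\<^sub>L real) set" where
  "subdifferential f x = {g. \<forall>y. f y \<ge> f x + blinfun_apply g (y - x)}"

definition curvature_bound :: "('a::real_normed_vector \<Rightarrow> real) \<Rightarrow> real \<Rightarrow> ereal" where
  "curvature_bound f t =
     Sup {ereal ((\<alpha> * f x + (1 - \<alpha>) * f y - f (\<alpha> *\<^sub>R x + (1 - \<alpha>) *\<^sub>R y)) / (\<alpha> * (1 - \<alpha>)))
          | x y \<alpha>. 0 < \<alpha> \<and> \<alpha> < 1 \<and> norm (x - y) \<le> t}"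

definition regular_curvature :: "('a::real_normed_vector \<Rightarrow> real) \<Rightarrow> bool" where
  "regular_curvature f \<longleftrightarrow>
     (\<forall>t\<ge>0. curvature_bound f t < \<infinity>) \<and>
     ((\<lambda>\<tau>. ereal (1 / \<tau>) * curvature_bound f \<tau>) \<longlongrightarrow> 0) (at_right 0)"

text \<open>
  For a convex, regular and non-affine \<open>f\<close> the curvature bound is a bijection of the nonnegative
  reals onto themselves; nothing is claimed about the next two functions for other \<open>f\<close>.
\<close>

definition complexity_gauge :: "('a::real_normed_vector \<Rightarrow> real) \<Rightarrow> real \<Rightarrow> real" where
  "complexity_gauge f \<epsilon> = the_inv_into {0..} (curvature_bound f) (ereal \<epsilon>)"

definition gamma_gauge :: "('a::real_normed_vector \<Rightarrow> real) \<Rightarrow> real \<Rightarrow> real" where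
  "gamma_gauge f t = t / (complexity_gauge f (t / 2))\<^sup>2"

text \<open>
  The map \<open>d'\<close> is the gradient of \<open>d\<close>. The iterates may lie on the boundary of \<open>Q\<close>, so the derivative
  is taken relative to \<open>Q\<close> at every point of \<open>Q\<close>; it is unique because \<open>Q\<close> is convex with nonempty
  interior, and on the interior it is the ordinary derivative. Strong convexity is required at
  interior points only.
\<close>

definition prox_function ::
    "'a::real_normed_vector set \<Rightarrow> ('a \<Rightarrow> real) \<Rightarrow> ('a \<Rightarrow> 'a \<Rightarrow>\<^sub>L real) \<Rightarrow> bool" where
  "prox_function Q d d' \<longleftrightarrow>
     convex_on Q d \<and>
     (\<forall>x\<in>Q. (d has_derivative blinfun_apply (d' x)) (at x within Q)) \<and>
     (\<forall>x\<in>interior Q. \<forall>y\<in>Q.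
        d y \<ge> d x + blinfun_apply (d' x) (y - x) + 1 / 2 * (norm (y - x))\<^sup>2)"

definition bregman_dist ::
    "('a::real_normed_vector \<Rightarrow> real) \<Rightarrow> ('a \<Rightarrow> 'a \<Rightarrow>\<^sub>L real) \<Rightarrow> 'a \<Rightarrow> 'a \<Rightarrow> real" where
  "bregman_dist d d' x y = d y - d x - blinfun_apply (d' x) (y - x)"

definition bregman_model ::
    "('a::real_normed_vector \<Rightarrow> real) \<Rightarrow> ('a \<Rightarrow> 'a \<Rightarrow>\<^sub>L real) \<Rightarrow> ('a \<Rightarrow> real) \<Rightarrow>
     ('a \<Rightarrow> real) \<Rightarrow> ('a \<Rightarrow> 'a \<Rightarrow>\<^sub>L real) \<Rightarrow> real \<Rightarrow> 'a \<Rightarrow> 'a \<Rightarrow> real" where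
  "bregman_model f f' \<Psi> d d' M x y =
     f x + blinfun_apply (f' x) (y - x) + M * bregman_dist d d' x y + \<Psi> y"

definition bregman_map ::
    "('a::real_normed_vector \<Rightarrow> real) \<Rightarrow> ('a \<Rightarrow> 'a \<Rightarrow>\<^sub>L real) \<Rightarrow> 'a set \<Rightarrow> ('a \<Rightarrow> real) \<Rightarrow>
     ('a \<Rightarrow> real) \<Rightarrow> ('a \<Rightarrow> 'a \<Rightarrow>\<^sub>L real) \<Rightarrow> real \<Rightarrow> 'a \<Rightarrow> 'a" where
  "bregman_map f f' Q \<Psi> d d' M x = arg_min (bregman_model f f' \<Psi> d d' M x) (\<lambda>y. y \<in> Q)"

text \<open>
  The exponent \<open>i - 1\<close> below is an integer, \<open>-1\<close> for \<open>i = 0\<close>. That the line search succeeds at every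
  iteration, so that \<open>LEAST\<close> picks an accepted index, is not part of the definition of a run.
\<close>

definition line_search_index ::
    "('a::real_normed_vector \<Rightarrow> real) \<Rightarrow> ('a \<Rightarrow> 'a \<Rightarrow>\<^sub>L real) \<Rightarrow> 'a set \<Rightarrow> ('a \<Rightarrow> real) \<Rightarrow>
     ('a \<Rightarrow> real) \<Rightarrow> ('a \<Rightarrow> 'a \<Rightarrow>\<^sub>L real) \<Rightarrow> real \<Rightarrow> real \<Rightarrow> 'a \<Rightarrow> nat" where
  "line_search_index f f' Q \<Psi> d d' \<epsilon> L x =
     (LEAST i. let x' = bregman_map f f' Q \<Psi> d d' (2 ^ i * L) x in
        f x' \<le> f x + blinfun_apply (f' x) (x' - x)
               + 2 powi (int i - 1) * L * (norm (x' - x))\<^sup>2 + \<epsilon> / 2)"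

definition pgm_run ::
    "('a::real_normed_vector \<Rightarrow> real) \<Rightarrow> ('a \<Rightarrow> 'a \<Rightarrow>\<^sub>L real) \<Rightarrow> 'a set \<Rightarrow> ('a \<Rightarrow> real) \<Rightarrow>
     ('a \<Rightarrow> real) \<Rightarrow> ('a \<Rightarrow> 'a \<Rightarrow>\<^sub>L real) \<Rightarrow> real \<Rightarrow> 'a \<Rightarrow> real \<Rightarrow> (nat \<Rightarrow> 'a) \<Rightarrow> (nat \<Rightarrow> real) \<Rightarrow> bool" where
  "pgm_run f f' Q \<Psi> d d' \<epsilon> x0 L0 x L \<longleftrightarrow>
     x 0 = x0 \<and> L 0 = L0 \<and>
     (\<forall>k. let i = line_search_index f f' Q \<Psi> d d' \<epsilon> (L k) (x k) in
        x (Suc k) = bregman_map f f' Q \<Psi> d d' (2 ^ i * L k) (x k) \<and>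
        L (Suc k) = 2 powi (int i - 1) * L k)"

definition pgm_weight :: "(nat \<Rightarrow> real) \<Rightarrow> nat \<Rightarrow> real" where
  "pgm_weight L k = (\<Sum>i=0..k. 1 / L (Suc i))"

definition pgm_average ::
    "('a \<Rightarrow> real) \<Rightarrow> ('a \<Rightarrow> real) \<Rightarrow> (nat \<Rightarrow> 'a) \<Rightarrow> (nat \<Rightarrow> real) \<Rightarrow> nat \<Rightarrow> real" where
  "pgm_average f \<Psi> x L k =
     1 / pgm_weight L k * (\<Sum>i=0..k. 1 / L (Suc i) * (f (x (Suc i)) + \<Psi> (x (Suc i))))"

end

theory Submission
  imports Defs
begin

text \<open>
  Why the method converges. Let \<open>s\<close> be the radius at which the curvature bound equals \<open>\<epsilon> / 2\<close>, so that
  \<open>\<gamma> = \<epsilon> / s\<^sup>2\<close> is the gauge value \<open>gamma_gauge f \<epsilon>\<close>. Up to distance \<open>s\<close>, the error of the linear model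
  of \<open>f\<close> at any point is at most \<open>\<epsilon> / 2\<close>. Hence the subgradient increment over a step of length \<open>s\<close>, paired
  with that step, is at most \<open>\<epsilon>\<close>, and cutting a longer displacement into steps of length \<open>s\<close> (plus a
  remainder) shows that the error grows at most quadratically:
  \<open>f y \<le> f x + f' x (y - x) + \<gamma> / 2 * (norm (y - x))\<^sup>2 + \<epsilon> / 2\<close> for all \<open>x\<close> and \<open>y\<close>
  (\<open>inexact_quadratic_upper_bound\<close>). The line search therefore accepts as soon as its coefficient
  reaches \<open>\<gamma>\<close>, and since it doubles the coefficient while the returned value is half the accepted one, \<open>L k\<close>
  stays below \<open>\<gamma>\<close> (\<open>line_search_accepted\<close>).

  The radius \<open>s\<close> exists and is unique because the curvature bound \<open>m\<close> of a non-affine convex function is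
  a strictly increasing continuous bijection of the nonnegative reals. Monotonicity and growth come from
  \<open>c * m t \<le> m (c * t)\<close> for \<open>c \<ge> 1\<close> together with \<open>m > 0\<close> off the origin; continuity comes from
  \<open>m (c * t) \<le> m t + 6 * (c - 1) * m t\<close> for \<open>1 \<le> c \<le> 2\<close>. Positivity is once more the cutting argument: if
  the linear models are exact up to some positive distance, they are exact everywhere.

  An accepted step with coefficient \<open>M = 2 * L (Suc k)\<close> satisfies the usual mirror-descent inequality:
  the quadratic term is absorbed by \<open>M\<close> times the Bregman distance, and the minimizer of the Bregman
  model improves on any competitor \<open>y\<close> by \<open>M\<close> times the Bregman distance to \<open>y\<close> (\<open>composite_descent\<close>).
  Dividing by \<open>L (Suc k)\<close> and summing, the Bregman distances telescope, which gives the estimate for the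
  weighted average; the rate follows from \<open>1 / L (Suc i) \<ge> 1 / \<gamma>\<close>. Iterates may reach the boundary of
  \<open>Q\<close>, so strong convexity of the prox-function is first transported there from the interior
  (\<open>bregman_dist_ge\<close>).
\<close>
section \<open>Linearization gaps and the curvature bound\<close>

text \<open>
  The Bregman distance of \<open>f\<close> from \<open>x\<close> to \<open>x + h\<close>, taken with the chosen subgradient \<open>f'\<close> and indexed by
  the displacement \<open>h\<close> because all estimates below scale or concatenate displacements.
\<close>
definition linearization_gap ::
    "('a::real_normed_vector \<Rightarrow> real) \<Rightarrow> ('a \<Rightarrow> 'a \<Rightarrow>\<^sub>L real) \<Rightarrow> 'a \<Rightarrow> 'a \<Rightarrow> real" where
  "linearization_gap f f' x h = f (x + h) - f x - blinfun_apply (f' x) h"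

text \<open>
  The quotient in the curvature bound for the chord with endpoints \<open>z - (1 - \<alpha>) h\<close> and \<open>z + \<alpha> h\<close>,
  written as a difference of two slopes at the intermediate point \<open>z\<close>. In this form \<open>h\<close> can be
  stretched while \<open>z\<close> and \<open>\<alpha>\<close> stay fixed, which is how the curvature bound is compared at two radii.
\<close>
definition chord_gap :: "('a::real_normed_vector \<Rightarrow> real) \<Rightarrow> 'a \<Rightarrow> 'a \<Rightarrow> real \<Rightarrow> real" where
  "chord_gap f z h \<alpha> = (f (z + \<alpha> *\<^sub>R h) - f z) / \<alpha> - (f z - f (z - (1 - \<alpha>) *\<^sub>R h)) / (1 - \<alpha>)"

definition curvature_modulus :: "('a::real_normed_vector \<Rightarrow> real) \<Rightarrow> real \<Rightarrow> real" where
  "curvature_modulus f t = real_of_ereal (curvature_bound f t)"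

lemma chord_gap_eq:
  assumes "0 < \<alpha>" "\<alpha> < 1" and z: "z = \<alpha> *\<^sub>R x + (1 - \<alpha>) *\<^sub>R y"
  shows "chord_gap f z (y - x) \<alpha> = (\<alpha> * f x + (1 - \<alpha>) * f y - f z) / (\<alpha> * (1 - \<alpha>))"
proof -
  have "z + \<alpha> *\<^sub>R (y - x) = y" "z - (1 - \<alpha>) *\<^sub>R (y - x) = x"
    by (auto simp: z algebra_simps)
  then show ?thesis
    using assms(1,2) by (simp add: chord_gap_def field_simps)
qed

lemma curvature_bound_eq_Sup_chord_gap:
  "curvature_bound f t = Sup {ereal (chord_gap f z h \<alpha>) | z h \<alpha>. 0 < \<alpha> \<and> \<alpha> < 1 \<and> norm h \<le> t}"
proof -
  have "{ereal ((\<alpha> * f x + (1 - \<alpha>) * f y - f (\<alpha> *\<^sub>R x + (1 - \<alpha>) *\<^sub>R y)) / (\<alpha> * (1 - \<alpha>)))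
          | x y \<alpha>. 0 < \<alpha> \<and> \<alpha> < 1 \<and> norm (x - y) \<le> t}
      = {ereal (chord_gap f z h \<alpha>) | z h \<alpha>. 0 < \<alpha> \<and> \<alpha> < 1 \<and> norm h \<le> t}" (is "?A = ?B")
  proof
    show "?A \<subseteq> ?B"
    proof clarify
      fix x y :: 'a and \<alpha> :: real
      assume a: "0 < \<alpha>" "\<alpha> < 1" and n: "norm (x - y) \<le> t"
      show "\<exists>z h \<alpha>'. ereal ((\<alpha> * f x + (1 - \<alpha>) * f y - f (\<alpha> *\<^sub>R x + (1 - \<alpha>) *\<^sub>R y)) / (\<alpha> * (1 - \<alpha>)))
              = ereal (chord_gap f z h \<alpha>') \<and> 0 < \<alpha>' \<and> \<alpha>' < 1 \<and> norm h \<le> t"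
        using a n chord_gap_eq[OF a refl, of f x y] by (metis norm_minus_commute)
    qed
    show "?B \<subseteq> ?A"
    proof clarify
      fix z h :: 'a and \<alpha> :: real
      assume a: "0 < \<alpha>" "\<alpha> < 1" and n: "norm h \<le> t"
      define x y where "x = z - (1 - \<alpha>) *\<^sub>R h" and "y = z + \<alpha> *\<^sub>R h"
      have z: "z = \<alpha> *\<^sub>R x + (1 - \<alpha>) *\<^sub>R y" and h: "h = y - x"
        by (auto simp: x_def y_def algebra_simps)
      have "norm (x - y) \<le> t"
        using n h by (simp add: norm_minus_commute)
      moreover have "ereal (chord_gap f z h \<alpha>)
          = ereal ((\<alpha> * f x + (1 - \<alpha>) * f y - f (\<alpha> *\<^sub>R x + (1 - \<alpha>) *\<^sub>R y)) / (\<alpha> * (1 - \<alpha>)))"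
        using chord_gap_eq[OF a z] z h by simp
      ultimately show "\<exists>x y \<alpha>'. ereal (chord_gap f z h \<alpha>)
          = ereal ((\<alpha>' * f x + (1 - \<alpha>') * f y - f (\<alpha>' *\<^sub>R x + (1 - \<alpha>') *\<^sub>R y)) / (\<alpha>' * (1 - \<alpha>')))
            \<and> 0 < \<alpha>' \<and> \<alpha>' < 1 \<and> norm (x - y) \<le> t"
        using a by blast
    qed
  qed
  then show ?thesis
    by (simp add: curvature_bound_def)
qed

locale finite_curvature =
  fixes f :: "'a::real_normed_vector \<Rightarrow> real" and f' :: "'a \<Rightarrow> 'a \<Rightarrow>\<^sub>L real"
  assumes convex_f: "convex_on UNIV f"
    and subgradient: "f' z \<in> subdifferential f z"
    and curvature_finite: "t \<ge> 0 \<Longrightarrow> curvature_bound f t < \<infinity>"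
begin

abbreviation D where "D \<equiv> linearization_gap f f'"
abbreviation m where "m \<equiv> curvature_modulus f"

lemma gap_nonneg: "0 \<le> D x h"
proof -
  have "f (x + h) \<ge> f x + blinfun_apply (f' x) (x + h - x)"
    using subgradient[of x] unfolding subdifferential_def by blast
  then show ?thesis by (simp add: linearization_gap_def)
qed

lemma gap_zero [simp]: "D x 0 = 0"
  by (simp add: linearization_gap_def)

text \<open>
  Concatenating two displacements costs, besides the two gaps, the change of the subgradient along the
  first one. This identity drives both the continuity of the modulus and the cutting argument.
\<close>
lemma gap_add:
  "D x (v + w) = D x v + D (x + v) w + (blinfun_apply (f' (x + v)) w - blinfun_apply (f' x) w)"
  by (simp add: linearization_gap_def blinfun.add_right add.assoc)

lemma gradient_increment:
  "blinfun_apply (f' (x + v)) v - blinfun_apply (f' x) v = D x v + D (x + v) (- v)"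
  by (simp add: linearization_gap_def blinfun.minus_right)

lemma gap_convex:
  assumes "0 \<le> \<theta>" "\<theta> \<le> 1"
  shows "D x ((1 - \<theta>) *\<^sub>R u + \<theta> *\<^sub>R v) \<le> (1 - \<theta>) * D x u + \<theta> * D x v"
proof -
  have "f ((1 - \<theta>) *\<^sub>R (x + u) + \<theta> *\<^sub>R (x + v)) \<le> (1 - \<theta>) * f (x + u) + \<theta> * f (x + v)"
    by (rule convex_onD[OF convex_f]) (use assms in auto)
  moreover have "(1 - \<theta>) *\<^sub>R (x + u) + \<theta> *\<^sub>R (x + v) = x + ((1 - \<theta>) *\<^sub>R u + \<theta> *\<^sub>R v)"
    by (simp add: algebra_simps)
  moreover have "blinfun_apply (f' x) ((1 - \<theta>) *\<^sub>R u + \<theta> *\<^sub>R v)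
      = (1 - \<theta>) * blinfun_apply (f' x) u + \<theta> * blinfun_apply (f' x) v"
    by (simp add: blinfun.add_right blinfun.scaleR_right)
  ultimately show ?thesis
    unfolding linearization_gap_def by (simp add: right_diff_distrib left_diff_distrib)
qed

lemma gap_scale_ge:
  assumes "c \<ge> 1"
  shows "c * D x v \<le> D x (c *\<^sub>R v)"
  using gap_convex[of "1 / c" x 0 "c *\<^sub>R v"] assms by (simp add: field_simps)

text \<open>
  The two slopes may be measured relative to the linear model at \<open>z\<close>: its contributions cancel. What is left
  is a sum of two nonnegative terms that can be estimated separately.
\<close>
lemma chord_gap_eq_gaps:
  assumes "0 < \<alpha>" "\<alpha> < 1"
  shows "chord_gap f z h \<alpha> = D z (\<alpha> *\<^sub>R h) / \<alpha> + D z ((1 - \<alpha>) *\<^sub>R (- h)) / (1 - \<alpha>)"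
proof -
  have "D z (\<alpha> *\<^sub>R h) / \<alpha> = (f (z + \<alpha> *\<^sub>R h) - f z) / \<alpha> - blinfun_apply (f' z) h"
    using assms by (simp add: linearization_gap_def blinfun.scaleR_right diff_divide_distrib)
  moreover have "D z ((1 - \<alpha>) *\<^sub>R (- h)) / (1 - \<alpha>)
      = (f (z - (1 - \<alpha>) *\<^sub>R h) - f z) / (1 - \<alpha>) + blinfun_apply (f' z) h"
    using assms by (simp add: linearization_gap_def blinfun.scaleR_right blinfun.minus_right
        diff_divide_distrib add_divide_distrib)
  ultimately show ?thesis
    by (simp add: chord_gap_def diff_divide_distrib)
qed

lemma chord_gap_le_bound:
  assumes "0 < \<alpha>" "\<alpha> < 1" "norm h \<le> t"
  shows "ereal (chord_gap f z h \<alpha>) \<le> curvature_bound f t"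
  unfolding curvature_bound_eq_Sup_chord_gap by (rule Sup_upper) (use assms in blast)

lemma curvature_bound_real:
  assumes "t \<ge> 0"
  shows "curvature_bound f t = ereal (m t)"
proof -
  have "ereal (chord_gap f 0 0 (1/2)) \<le> curvature_bound f t"
    by (rule chord_gap_le_bound) (use assms in auto)
  then have "\<bar>curvature_bound f t\<bar> \<noteq> \<infinity>"
    using curvature_finite[OF assms] by (cases "curvature_bound f t") auto
  then show ?thesis
    by (simp add: curvature_modulus_def ereal_real')
qed

lemma chord_gap_le:
  assumes "0 < \<alpha>" "\<alpha> < 1" "norm h \<le> t"
  shows "chord_gap f z h \<alpha> \<le> m t"
proof -
  have "t \<ge> 0" using assms(3) norm_ge_zero[of h] by linarith
  then show ?thesis
    using chord_gap_le_bound[OF assms, of z] by (simp add: curvature_bound_real)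
qed

lemma modulus_least:
  assumes "t \<ge> 0"
    and "\<And>z h \<alpha>. 0 < \<alpha> \<Longrightarrow> \<alpha> < 1 \<Longrightarrow> norm h \<le> t \<Longrightarrow> chord_gap f z h \<alpha> \<le> b"
  shows "m t \<le> b"
proof -
  have "curvature_bound f t \<le> ereal b"
    unfolding curvature_bound_eq_Sup_chord_gap by (rule Sup_least) (use assms(2) in auto)
  then show ?thesis
    using assms(1) by (simp add: curvature_bound_real)
qed

lemma modulus_mono:
  assumes "0 \<le> t" "t \<le> u"
  shows "m t \<le> m u"
  by (rule modulus_least) (use assms in \<open>auto intro: chord_gap_le\<close>)

lemma modulus_nonneg:
  assumes "0 \<le> t"
  shows "0 \<le> m t"
proof -
  have "chord_gap f 0 0 (1/2) \<le> m t"
    by (rule chord_gap_le) (use assms in auto)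
  then show ?thesis by (simp add: chord_gap_def)
qed

lemma modulus_zero: "m 0 = 0"
proof -
  have "m 0 \<le> 0"
    by (rule modulus_least) (auto simp: chord_gap_def)
  then show ?thesis
    using modulus_nonneg[of 0] by simp
qed

text \<open>
  A convex function vanishing at the origin, such as the gap at \<open>z\<close>, grows at least linearly along rays,
  and the chord gap is a positive combination of two gaps at the same \<open>z\<close>.
\<close>
lemma modulus_scale_ge:
  assumes c: "c \<ge> 1" and t: "t \<ge> 0"
  shows "c * m t \<le> m (c * t)"
proof -
  have "m t \<le> m (c * t) / c"
  proof (rule modulus_least[OF t])
    fix z h :: 'a and \<alpha> :: real
    assume a: "0 < \<alpha>" "\<alpha> < 1" and h: "norm h \<le> t"
    have "c * D z (\<alpha> *\<^sub>R h) \<le> D z (\<alpha> *\<^sub>R c *\<^sub>R h)"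
      using gap_scale_ge[OF c, of z "\<alpha> *\<^sub>R h"] by (simp add: mult.commute)
    moreover have "c * D z ((1 - \<alpha>) *\<^sub>R (- h)) \<le> D z ((1 - \<alpha>) *\<^sub>R (- (c *\<^sub>R h)))"
      using gap_scale_ge[OF c, of z "(1 - \<alpha>) *\<^sub>R (- h)"] by (simp add: mult.commute)
    ultimately have "c * chord_gap f z h \<alpha> \<le> chord_gap f z (c *\<^sub>R h) \<alpha>"
      unfolding chord_gap_eq_gaps[OF a] distrib_left times_divide_eq_right
      using a by (intro add_mono divide_right_mono) auto
    also have "\<dots> \<le> m (c * t)"
      by (rule chord_gap_le) (use a h c in \<open>auto intro!: mult_left_mono\<close>)
    finally show "chord_gap f z h \<alpha> \<le> m (c * t) / c"
      using c by (simp add: field_simps)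
  qed
  then show ?thesis
    using c by (simp add: field_simps)
qed

lemma modulus_scale_le:
  assumes "0 \<le> c" "c \<le> 1" "t \<ge> 0"
  shows "m (c * t) \<le> c * m t"
proof (cases "c = 0")
  case False
  then show ?thesis
    using modulus_scale_ge[of "1 / c" "c * t"] assms by (simp add: field_simps)
qed (simp add: modulus_zero)

text \<open>
  For \<open>\<alpha> < 1\<close> the gap at \<open>\<alpha> h\<close> is, after division by \<open>\<alpha>\<close>, one of the two nonnegative parts of a chord gap
  with chord vector \<open>h\<close>, so it is at most \<open>\<alpha>\<close> times the modulus. It remains to let \<open>\<alpha>\<close> tend to \<open>1\<close>.
\<close>
lemma gap_le_modulus: "D z h \<le> m (norm h)"
proof (rule tendsto_le)
  \<comment> \<open>Convexity between \<open>\<alpha> h\<close> and \<open>2 h\<close> passes to the limit: the weight \<open>(1 - \<alpha>) / (2 - \<alpha>)\<close> of the far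
      point, whose gap is a fixed number, vanishes.\<close>
  let ?b = "\<lambda>\<alpha>. (1 / (2 - \<alpha>)) * (\<alpha> * m (norm h)) + (1 - \<alpha>) / (2 - \<alpha>) * D z (2 *\<^sub>R h)"
  have "(?b \<longlongrightarrow> (1 / (2 - 1)) * (1 * m (norm h)) + (1 - 1) / (2 - 1) * D z (2 *\<^sub>R h)) (at_left 1)"
    by (intro tendsto_intros) auto
  then show "(?b \<longlongrightarrow> m (norm h)) (at_left 1)" by simp
  show "((\<lambda>\<alpha>. D z h) \<longlongrightarrow> D z h) (at_left (1::real))" by simp
  have "eventually (\<lambda>\<alpha>. \<alpha> \<in> {0<..<1}) (at_left (1::real))"
    by (rule eventually_at_left_real) simp
  then show "eventually (\<lambda>\<alpha>. D z h \<le> ?b \<alpha>) (at_left (1::real))"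
  proof eventually_elim
    case (elim \<alpha>)
    then have a: "0 < \<alpha>" "\<alpha> < 1" by auto
    have "D z (\<alpha> *\<^sub>R h) / \<alpha> \<le> chord_gap f z h \<alpha>"
      unfolding chord_gap_eq_gaps[OF a] using a gap_nonneg[of z "(1 - \<alpha>) *\<^sub>R (- h)"] by simp
    also have "\<dots> \<le> m (norm h)"
      by (rule chord_gap_le) (use a in auto)
    finally have near: "D z (\<alpha> *\<^sub>R h) \<le> \<alpha> * m (norm h)"
      using a by (simp add: field_simps)
    define \<theta> where "\<theta> = (1 - \<alpha>) / (2 - \<alpha>)"
    have th: "0 \<le> \<theta>" "\<theta> \<le> 1" "1 - \<theta> = 1 / (2 - \<alpha>)"
      using a by (auto simp: \<theta>_def field_simps)
    have "(1 - \<theta>) * \<alpha> + \<theta> * 2 = 1"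
      using a by (simp add: \<theta>_def divide_simps)
    then have "(1 - \<theta>) *\<^sub>R \<alpha> *\<^sub>R h + \<theta> *\<^sub>R 2 *\<^sub>R h = h"
      by (metis scaleR_add_left scaleR_one scaleR_scaleR)
    then have "D z h \<le> (1 - \<theta>) * D z (\<alpha> *\<^sub>R h) + \<theta> * D z (2 *\<^sub>R h)"
      using gap_convex[OF th(1,2), of z "\<alpha> *\<^sub>R h" "2 *\<^sub>R h"] by simp
    also have "\<dots> \<le> (1 - \<theta>) * (\<alpha> * m (norm h)) + \<theta> * D z (2 *\<^sub>R h)"
      using near th a by (intro add_mono mult_left_mono) auto
    finally show ?case
      unfolding th(3) by (simp add: \<theta>_def)
  qed
qed simp

text \<open>
  Stretching \<open>w = \<alpha> v\<close> to \<open>c w\<close> appends the short displacement \<open>(c - 1) w\<close>. Its own gap contributes one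
  unit of \<open>(c - 1) * m t\<close>, and the subgradient increment along \<open>w\<close>, a sum of two gaps, contributes two.
  Dividing by \<open>\<alpha>\<close> keeps the error independent of \<open>\<alpha>\<close>, as needed for a supremum over all \<open>\<alpha>\<close>.
\<close>
lemma gap_stretch:
  assumes a: "0 < \<alpha>" "\<alpha> < 1" and c: "1 \<le> c" "c \<le> 2" and v: "norm v \<le> t"
  shows "D z (\<alpha> *\<^sub>R c *\<^sub>R v) / \<alpha> \<le> D z (\<alpha> *\<^sub>R v) / \<alpha> + 3 * (c - 1) * m t"
proof -
  have t: "t \<ge> 0" using v norm_ge_zero[of v] by linarith
  define w where "w = \<alpha> *\<^sub>R v"
  have w: "norm w \<le> \<alpha> * t"
    using a v by (simp add: w_def mult_left_mono)
  have small: "D x u \<le> b * m t" if "norm u \<le> b * t" "0 \<le> b" "b \<le> 1" for x u b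
  proof -
    have "D x u \<le> m (norm u)" by (rule gap_le_modulus)
    also have "\<dots> \<le> m (b * t)" by (rule modulus_mono) (use that in auto)
    also have "\<dots> \<le> b * m t" by (rule modulus_scale_le) (use that t in auto)
    finally show ?thesis .
  qed
  have tail: "D (z + w) ((c - 1) *\<^sub>R w) \<le> ((c - 1) * \<alpha>) * m t"
  proof (rule small)
    show "norm ((c - 1) *\<^sub>R w) \<le> (c - 1) * \<alpha> * t"
      using mult_left_mono[OF w, of "c - 1"] c by (simp add: mult.assoc)
    show "(c - 1) * \<alpha> \<le> 1" using mult_mono[of "c - 1" 1 \<alpha> 1] a c by simp
  qed (use a c in auto)
  have "blinfun_apply (f' (z + w)) w - blinfun_apply (f' z) w \<le> 2 * (\<alpha> * m t)"
    unfolding gradient_increment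
    using small[of w \<alpha> z] small[of "- w" \<alpha> "z + w"] w a by simp
  then have incr: "(c - 1) * (blinfun_apply (f' (z + w)) w - blinfun_apply (f' z) w)
      \<le> (c - 1) * (2 * (\<alpha> * m t))"
    using c by (intro mult_left_mono) auto
  have "\<alpha> *\<^sub>R c *\<^sub>R v = w + (c - 1) *\<^sub>R w"
    by (simp add: w_def algebra_simps)
  then have "D z (\<alpha> *\<^sub>R c *\<^sub>R v) = D z w + D (z + w) ((c - 1) *\<^sub>R w)
      + (c - 1) * (blinfun_apply (f' (z + w)) w - blinfun_apply (f' z) w)"
    by (simp add: gap_add blinfun.scaleR_right right_diff_distrib)
  also have "\<dots> \<le> D z w + ((c - 1) * \<alpha>) * m t + (c - 1) * (2 * (\<alpha> * m t))"
    using tail incr by linarith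
  also have "\<dots> = (D z w / \<alpha> + 3 * (c - 1) * m t) * \<alpha>"
    using a by (simp add: algebra_simps)
  finally show ?thesis
    using a by (simp add: w_def pos_divide_le_eq)
qed

lemma modulus_stretch:
  assumes c: "1 \<le> c" "c \<le> 2" and t: "t \<ge> 0"
  shows "m (c * t) \<le> m t + 6 * (c - 1) * m t"
proof (rule modulus_least)
  fix z h' :: 'a and \<alpha> :: real
  assume a: "0 < \<alpha>" "\<alpha> < 1" and h': "norm h' \<le> c * t"
  define h where "h = (1 / c) *\<^sub>R h'"
  have h: "norm h \<le> t" and h'_eq: "h' = c *\<^sub>R h"
    using h' c by (auto simp: h_def field_simps)
  have "D z (\<alpha> *\<^sub>R h') / \<alpha> \<le> D z (\<alpha> *\<^sub>R h) / \<alpha> + 3 * (c - 1) * m t"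
    unfolding h'_eq by (rule gap_stretch[OF a c h])
  moreover have "D z ((1 - \<alpha>) *\<^sub>R (- h')) / (1 - \<alpha>)
      \<le> D z ((1 - \<alpha>) *\<^sub>R (- h)) / (1 - \<alpha>) + 3 * (c - 1) * m t"
    using gap_stretch[of "1 - \<alpha>" c "- h" t z] a c h by (simp add: h'_eq)
  ultimately have "chord_gap f z h' \<alpha> \<le> chord_gap f z h \<alpha> + 6 * (c - 1) * m t"
    unfolding chord_gap_eq_gaps[OF a] by linarith
  then have "chord_gap f z h' \<alpha> \<le> m t + 6 * (c - 1) * m t"
    using chord_gap_le[OF a h, of z] by linarith
  then show "chord_gap f z h' \<alpha> \<le> m t + 6 * (c - 1) * m t" .
qed (use c t in auto)

text \<open>
  Away from the origin the modulus is even Lipschitz on bounded intervals. For radii with ratio at most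
  \<open>2\<close> this is \<open>modulus_stretch\<close>; for larger ratios the trivial bound by \<open>m b\<close> suffices.
\<close>
lemma modulus_continuous:
  assumes "0 < a"
  shows "continuous_on {a..b} m"
proof (cases "a \<le> b")
  case True
  define C where "C = 6 * m b / a"
  have mb: "0 \<le> m b" using modulus_nonneg assms True by auto
  have step: "m u - m t \<le> C * (u - t)" if "a \<le> t" "t \<le> u" "u \<le> b" for t u
  proof -
    have t0: "t > 0" using that assms by linarith
    have "m u - m t \<le> 6 * (u / t - 1) * m b"
    proof (cases "u \<le> 2 * t")
      case True
      have "m u - m t \<le> 6 * (u / t - 1) * m t"
        using modulus_stretch[of "u / t" t] that t0 True by (simp add: field_simps)
      also have "\<dots> \<le> 6 * (u / t - 1) * m b"
        using that t0 by (intro mult_left_mono modulus_mono) (auto simp: field_simps)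
      finally show ?thesis .
    next
      case False
      have "m u - m t \<le> 1 * m b"
        using modulus_mono[of u b] modulus_nonneg[of t] that t0 by auto
      also have "\<dots> \<le> 6 * (u / t - 1) * m b"
        using False t0 mb by (intro mult_right_mono) (auto simp: field_simps)
      finally show ?thesis .
    qed
    also have "\<dots> = 6 * m b * (u - t) / t"
      using t0 by (simp add: field_simps)
    also have "\<dots> \<le> 6 * m b * (u - t) / a"
      using that assms mb by (intro divide_left_mono) auto
    finally show ?thesis by (simp add: C_def)
  qed
  have "C-lipschitz_on {a..b} m"
  proof (rule lipschitz_on_leI)
    show "dist (m t) (m u) \<le> C * dist t u" if "t \<in> {a..b}" "u \<in> {a..b}" "t \<le> u" for t u
      using step[of t u] modulus_mono[of t u] that assms by (auto simp: dist_real_def)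
    show "0 \<le> C" using mb assms by (simp add: C_def)
  qed
  then show ?thesis by (rule lipschitz_on_continuous_on)
qed simp

section \<open>From short to long displacements\<close>

text \<open>
  The subgradient gains at most \<open>2 \<delta>\<close> on \<open>w\<close> with each step, so step number \<open>j\<close>, counted from zero, adds
  at most \<open>\<delta> + 2 j \<delta>\<close> to the gap; these odd multiples of \<open>\<delta>\<close> sum to \<open>n\<^sup>2 \<delta>\<close>.
\<close>
lemma gap_steps:
  assumes short: "\<And>x h. norm h \<le> s \<Longrightarrow> D x h \<le> \<delta>" and w: "norm w \<le> s"
  shows "blinfun_apply (f' (x + real n *\<^sub>R w)) w - blinfun_apply (f' x) w \<le> 2 * real n * \<delta>"
    and "D x (real n *\<^sub>R w) \<le> (real n)\<^sup>2 * \<delta>"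
proof (induction n)
  case 0
  { case 1 show ?case by simp }
  { case 2 show ?case by simp }
next
  case (Suc n)
  let ?y = "x + real n *\<^sub>R w"
  have y: "x + real (Suc n) *\<^sub>R w = ?y + w" and w_eq: "real (Suc n) *\<^sub>R w = real n *\<^sub>R w + w"
    by (auto simp: algebra_simps)
  have last: "D ?y w \<le> \<delta>" "D (?y + w) (- w) \<le> \<delta>"
    using short w by auto
  { case 1
    show ?case
      using Suc.IH(1) last gradient_increment[of ?y w] unfolding y by (simp add: algebra_simps) }
  { case 2
    show ?case
      using Suc.IH last(1) unfolding w_eq gap_add
      by (simp add: algebra_simps power2_eq_square) }
qed

text \<open>
  Write \<open>norm h / s = n + q\<close> with \<open>n\<close> a natural number and \<open>q\<close> the fractional part. The \<open>n\<close> full steps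
  cost \<open>n\<^sup>2 \<delta>\<close>, the remainder \<open>\<delta> + 2 n q \<delta>\<close>, and the total is at most \<open>((n + q)\<^sup>2 + 1) \<delta>\<close>. The additive
  constant pays for the remainder, which may cost \<open>\<delta>\<close> however short it is.
\<close>
lemma gap_quadratic:
  assumes short: "\<And>x h. norm h \<le> s \<Longrightarrow> D x h \<le> \<delta>" and s: "s > 0"
  shows "D x h \<le> \<delta> * ((norm h / s)\<^sup>2 + 1)"
proof -
  have \<delta>: "0 \<le> \<delta>" using short[of 0 x] s by simp
  show ?thesis
  proof (cases "h = 0")
    case True
    then show ?thesis using \<delta> by simp
  next
    case False
    define w where "w = (s / norm h) *\<^sub>R h"
    define r where "r = norm h / s"
    define n where "n = nat \<lfloor>r\<rfloor>"
    define q where "q = r - real n"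
    have r: "r \<ge> 0" using s by (simp add: r_def)
    have q: "0 \<le> q" "q \<le> 1" using r by (auto simp: q_def n_def) linarith
    have w: "norm w \<le> s" using False s by (simp add: w_def)
    have "h = r *\<^sub>R w" using False s by (simp add: r_def w_def)
    then have h: "h = real n *\<^sub>R w + q *\<^sub>R w" by (simp add: q_def algebra_simps)
    let ?y = "x + real n *\<^sub>R w"
    have "norm (q *\<^sub>R w) \<le> s"
      using mult_mono[of q 1 "norm w" s] q w by simp
    then have tail: "D ?y (q *\<^sub>R w) \<le> \<delta>" by (rule short)
    have "D x h = D x (real n *\<^sub>R w) + D ?y (q *\<^sub>R w)
        + q * (blinfun_apply (f' ?y) w - blinfun_apply (f' x) w)"
      unfolding h gap_add by (simp add: blinfun.scaleR_right right_diff_distrib)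
    also have "\<dots> \<le> (real n)\<^sup>2 * \<delta> + \<delta> + q * (2 * real n * \<delta>)"
      using gap_steps[OF short w] tail q by (intro add_mono mult_left_mono) auto
    also have "\<dots> \<le> \<delta> * ((real n + q)\<^sup>2 + 1)"
      using \<delta> by (simp add: power2_eq_square algebra_simps)
    also have "real n + q = norm h / s" by (simp add: q_def r_def)
    finally show ?thesis .
  qed
qed

text \<open>
  A vanishing modulus at \<open>t\<close> makes the linear models exact up to distance \<open>t\<close>; the quadratic bound with
  \<open>\<delta> = 0\<close> then makes the model at the origin exact everywhere.
\<close>
lemma modulus_pos:
  assumes "\<not> affine_fun f" "t > 0"
  shows "m t > 0"
proof (rule ccontr)
  assume "\<not> m t > 0"
  then have m0: "m t \<le> 0" by simp
  have "D x h \<le> 0" if "norm h \<le> t" for x h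
    using gap_le_modulus[of x h] modulus_mono[of "norm h" t] that m0 by auto
  then have "D 0 h \<le> 0" for h
    using gap_quadratic[of t 0 0 h] assms(2) by auto
  then have gap0: "D 0 h = 0" for h
    using gap_nonneg[of 0 h] by (simp add: order_antisym)
  have "f h = blinfun_apply (f' 0) h + f 0" for h
    using gap0[of h] unfolding linearization_gap_def by simp
  then show False
    using assms(1) unfolding affine_fun_def by blast
qed

lemma modulus_strict_mono:
  assumes na: "\<not> affine_fun f" and "0 \<le> t" "t < u"
  shows "m t < m u"
proof (cases "t = 0")
  case True
  then show ?thesis using modulus_pos[OF na, of u] assms by (simp add: modulus_zero)
next
  case False
  then have t: "t > 0" using assms by simp
  have "m t < u / t * m t"
    using modulus_pos[OF na t] t assms by (simp add: field_simps)
  also have "\<dots> \<le> m u"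
    using modulus_scale_ge[of "u / t" t] t assms by simp
  finally show ?thesis .
qed

text \<open>
  Linear scaling from the reference radius \<open>1\<close> gives one radius where the modulus is at most \<open>e\<close> and one
  where it is at least \<open>e\<close>; both are positive, so continuity between them applies.
\<close>
lemma modulus_attains:
  assumes na: "\<not> affine_fun f" and e: "e > 0"
  shows "\<exists>s>0. m s = e"
proof -
  have m1: "m 1 > 0" by (rule modulus_pos[OF na]) simp
  define a b where "a = min 1 (e / m 1)" and "b = max 1 (e / m 1)"
  have ab: "0 < a" "a \<le> b" using e m1 by (auto simp: a_def b_def)
  have "m (a * 1) \<le> a * m 1"
    by (rule modulus_scale_le) (use ab in \<open>auto simp: a_def\<close>)
  also have "\<dots> \<le> e / m 1 * m 1"
    using m1 by (intro mult_right_mono) (auto simp: a_def)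
  finally have "m a \<le> e" using m1 by simp
  moreover have "e \<le> m b"
  proof -
    have "e = e / m 1 * m 1" using m1 by simp
    also have "\<dots> \<le> b * m 1" using m1 by (intro mult_right_mono) (auto simp: b_def)
    also have "\<dots> \<le> m (b * 1)" by (rule modulus_scale_ge) (auto simp: b_def)
    finally show ?thesis by simp
  qed
  ultimately obtain s where s: "a \<le> s" "m s = e"
    using IVT'[of m a e b] modulus_continuous[OF ab(1), of b] ab by auto
  show ?thesis
    by (rule exI[of _ s]) (use s ab in auto)
qed

lemma complexity_gauge_inverse:
  assumes na: "\<not> affine_fun f" and e: "e > 0"
  shows "complexity_gauge f e > 0" and "m (complexity_gauge f e) = e"
proof -
  obtain s where s: "s > 0" "m s = e"
    using modulus_attains[OF na e] by blast
  have "inj_on (curvature_bound f) {0..}"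
  proof (rule linorder_inj_onI)
    fix t u :: real
    assume "t < u" "t \<in> {0..}" "u \<in> {0..}"
    then show "curvature_bound f t \<noteq> curvature_bound f u"
      using modulus_strict_mono[OF na, of t u] by (simp add: curvature_bound_real)
  qed auto
  moreover have "curvature_bound f s = ereal e"
    using s by (simp add: curvature_bound_real)
  ultimately have "complexity_gauge f e = s"
    using s(1) the_inv_into_f_f[of "curvature_bound f" "{0..}" s]
    by (simp add: complexity_gauge_def)
  then show "complexity_gauge f e > 0" "m (complexity_gauge f e) = e"
    using s by auto
qed

lemma gamma_gauge_pos:
  assumes "\<not> affine_fun f" "e > 0"
  shows "gamma_gauge f e > 0"
  using complexity_gauge_inverse(1)[of "e / 2"] assms by (simp add: gamma_gauge_def)

lemma inexact_quadratic_upper_bound: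
  assumes na: "\<not> affine_fun f" and e: "e > 0" and M: "gamma_gauge f e \<le> M"
  shows "f y \<le> f x + blinfun_apply (f' x) (y - x) + M / 2 * (norm (y - x))\<^sup>2 + e / 2"
proof -
  define s where "s = complexity_gauge f (e / 2)"
  have s: "s > 0" "m s = e / 2"
    using complexity_gauge_inverse[OF na, of "e / 2"] e by (auto simp: s_def)
  have short: "D x h \<le> e / 2" if "norm h \<le> s" for x h
    using gap_le_modulus[of x h] modulus_mono[of "norm h" s] that s by auto
  have "D x (y - x) \<le> e / 2 * ((norm (y - x) / s)\<^sup>2 + 1)"
    by (rule gap_quadratic[OF short s(1)])
  also have "\<dots> = gamma_gauge f e / 2 * (norm (y - x))\<^sup>2 + e / 2"
    by (simp add: gamma_gauge_def s_def[symmetric] power_divide algebra_simps)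
  also have "\<dots> \<le> M / 2 * (norm (y - x))\<^sup>2 + e / 2"
    using M by (intro add_mono mult_right_mono) auto
  finally show ?thesis by (simp add: linearization_gap_def)
qed

end

section \<open>Prox-functions up to the boundary\<close>

text \<open>
  The derivative of \<open>d\<close> relative to \<open>Q\<close> controls difference quotients along segments inside \<open>Q\<close>, even when
  \<open>x\<close> is a boundary point.
\<close>
lemma directional_derivative:
  fixes d :: "'a::real_normed_vector \<Rightarrow> real"
  assumes Q: "convex Q" and x: "x \<in> Q" and y: "y \<in> Q"
    and d: "(d has_derivative blinfun_apply g) (at x within Q)"
  shows "((\<lambda>\<tau>. (d (x + \<tau> *\<^sub>R (y - x)) - d x) / \<tau>) \<longlongrightarrow> blinfun_apply g (y - x)) (at_right 0)"
proof -
  let ?p = "\<lambda>\<tau>::real. x + \<tau> *\<^sub>R (y - x)"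
  have p: "(?p has_derivative (\<lambda>\<tau>. \<tau> *\<^sub>R (y - x))) (at 0 within {0..1})"
    by (auto intro!: derivative_eq_intros)
  have sub: "?p ` {0..1} \<subseteq> Q"
    using Q x y unfolding convex_alt by (force simp: algebra_simps)
  have "(d has_derivative blinfun_apply g) (at (?p 0) within ?p ` {0..1})"
    using has_derivative_subset[OF d sub] by simp
  from has_derivative_in_compose[OF p this]
  have "((\<lambda>\<tau>. d (?p \<tau>)) has_derivative (\<lambda>\<tau>. blinfun_apply g (\<tau> *\<^sub>R (y - x)))) (at 0 within {0..1})" .
  moreover have "(\<lambda>\<tau>. blinfun_apply g (\<tau> *\<^sub>R (y - x))) = (*) (blinfun_apply g (y - x))"
    by (rule ext) (simp add: blinfun.scaleR_right)
  ultimately have "((\<lambda>\<tau>. d (?p \<tau>)) has_real_derivative blinfun_apply g (y - x)) (at 0 within {0..1})"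
    unfolding has_field_derivative_def by simp
  then have "((\<lambda>\<tau>. (d (?p \<tau>) - d x) / \<tau>) \<longlongrightarrow> blinfun_apply g (y - x)) (at 0 within {0..1})"
    by (simp add: has_field_derivative_iff)
  then show ?thesis
    by (simp add: at_within_Icc_at_right)
qed

text \<open>
  The contraction of the interior of \<open>Q\<close> towards \<open>x\<close> is an open subset of \<open>Q\<close>, in any normed space.
\<close>
lemma interior_convex_combination:
  fixes Q :: "'a::real_normed_vector set"
  assumes Q: "convex Q" and x: "x \<in> Q" and z: "z \<in> interior Q" and s: "0 < s" "s \<le> 1"
  shows "x + s *\<^sub>R (z - x) \<in> interior Q"
proof (rule interiorI)
  let ?T = "(\<lambda>w. (1 - s) *\<^sub>R x + w) ` (\<lambda>w. s *\<^sub>R w) ` interior Q"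
  show "open ?T"
    by (rule open_translation, rule open_scaling) (use s in auto)
  have "x + s *\<^sub>R (z - x) = (1 - s) *\<^sub>R x + s *\<^sub>R z"
    by (simp add: algebra_simps)
  then show "x + s *\<^sub>R (z - x) \<in> ?T"
    using z by blast
  show "?T \<subseteq> Q"
    using Q x s interior_subset[of Q] unfolding convex_alt by auto
qed

text \<open>
  The strong convexity inequality at an interior point \<open>p\<close> of a chord, applied to both endpoints and averaged,
  gives the chord inequality. For general \<open>x\<close> and \<open>y\<close> in \<open>Q\<close> the whole chord is first moved slightly towards an
  interior point \<open>z\<close>. The chord inequality involves only values of \<open>d\<close>, which are continuous along the
  motion, whereas the gradients at the moved points need not converge.
\<close>
lemma prox_function_chord_gap:
  fixes d :: "'a::real_normed_vector \<Rightarrow> real"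
  assumes d: "prox_function Q d d'" and int: "interior Q \<noteq> {}"
    and x: "x \<in> Q" and y: "y \<in> Q" and \<tau>: "0 < \<tau>" "\<tau> < 1"
  shows "d (x + \<tau> *\<^sub>R (y - x)) \<le> (1 - \<tau>) * d x + \<tau> * d y - \<tau> * (1 - \<tau>) / 2 * (norm (y - x))\<^sup>2"
proof -
  have Q: "convex Q"
    using d by (auto simp: prox_function_def convex_on_def)
  obtain z where z: "z \<in> interior Q" using int by blast
  let ?u = "x + \<tau> *\<^sub>R (y - x)"
  let ?x = "\<lambda>s::real. x + s *\<^sub>R (z - x)" and ?y = "\<lambda>s::real. y + s *\<^sub>R (z - y)"
    and ?p = "\<lambda>s::real. ?u + s *\<^sub>R (z - ?u)"
  have u: "?u \<in> Q"
    using Q x y \<tau> unfolding convex_alt by (force simp: algebra_simps)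
  have zQ: "z \<in> Q" using z interior_subset by blast
  have lim: "((\<lambda>s. d (a + s *\<^sub>R (z - a))) \<longlongrightarrow> d a) (at_right 0)" if a: "a \<in> Q" for a
  proof -
    have "(d has_derivative blinfun_apply (d' a)) (at a within Q)"
      using d a by (simp add: prox_function_def)
    from directional_derivative[OF Q a zQ this]
    have "((\<lambda>s. d a + s * ((d (a + s *\<^sub>R (z - a)) - d a) / s))
        \<longlongrightarrow> d a + 0 * blinfun_apply (d' a) (z - a)) (at_right 0)"
      by (intro tendsto_intros)
    then have "((\<lambda>s. d a + s * ((d (a + s *\<^sub>R (z - a)) - d a) / s)) \<longlongrightarrow> d a) (at_right 0)"
      by simp
    then show ?thesis
      by (rule Lim_transform_eventually) (auto simp: eventually_at_filter)
  qed
  show ?thesis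
  proof (rule tendsto_le)
    show "((\<lambda>s. d (?p s)) \<longlongrightarrow> d ?u) (at_right 0)"
      by (rule lim[OF u])
    have "((\<lambda>s. (1 - \<tau>) * d (?x s) + \<tau> * d (?y s) - \<tau> * (1 - \<tau>) / 2 * ((1 - s) * norm (y - x))\<^sup>2)
        \<longlongrightarrow> (1 - \<tau>) * d x + \<tau> * d y - \<tau> * (1 - \<tau>) / 2 * ((1 - 0) * norm (y - x))\<^sup>2) (at_right 0)"
      by (intro tendsto_intros lim x y)
    then show "((\<lambda>s. (1 - \<tau>) * d (?x s) + \<tau> * d (?y s) - \<tau> * (1 - \<tau>) / 2 * ((1 - s) * norm (y - x))\<^sup>2)
        \<longlongrightarrow> (1 - \<tau>) * d x + \<tau> * d y - \<tau> * (1 - \<tau>) / 2 * (norm (y - x))\<^sup>2) (at_right 0)"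
      by simp
    have "eventually (\<lambda>s. s \<in> {0<..<1}) (at_right (0::real))"
      by (rule eventually_at_right_real) simp
    then show "eventually (\<lambda>s. d (?p s) \<le> (1 - \<tau>) * d (?x s) + \<tau> * d (?y s)
        - \<tau> * (1 - \<tau>) / 2 * ((1 - s) * norm (y - x))\<^sup>2) (at_right (0::real))"
    proof eventually_elim
      case (elim s)
      then have s: "0 < s" "s < 1" by auto
      have int_s: "w + s *\<^sub>R (z - w) \<in> interior Q" if "w \<in> Q" for w
        by (rule interior_convex_combination[OF Q that z]) (use s in auto)
      have inQ: "?x s \<in> Q" "?y s \<in> Q" "?p s \<in> interior Q"
        using int_s[OF x] int_s[OF y] int_s[OF u] interior_subset[of Q] by blast+
      define v where "v = (1 - s) *\<^sub>R (y - x)"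
      have diffs: "?x s - ?p s = - (\<tau> *\<^sub>R v)" "?y s - ?p s = (1 - \<tau>) *\<^sub>R v"
        by (auto simp: v_def algebra_simps)
      have sc: "d (?p s) + blinfun_apply (d' (?p s)) (w - ?p s) + 1 / 2 * (norm (w - ?p s))\<^sup>2 \<le> d w"
        if "w \<in> Q" for w
        using d inQ(3) that by (auto simp: prox_function_def)
      let ?G = "blinfun_apply (d' (?p s)) v" and ?N = "(norm v)\<^sup>2"
      have dx: "d (?p s) - \<tau> * ?G + \<tau>\<^sup>2 / 2 * ?N \<le> d (?x s)"
        using sc[OF inQ(1)] \<tau> unfolding diffs
        by (simp add: blinfun.scaleR_right blinfun.minus_right power_mult_distrib)
      have dy: "d (?p s) + (1 - \<tau>) * ?G + (1 - \<tau>)\<^sup>2 / 2 * ?N \<le> d (?y s)"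
        using sc[OF inQ(2)] \<tau> unfolding diffs
        by (simp add: blinfun.scaleR_right power_mult_distrib)
      have "(1 - \<tau>) * (d (?p s) - \<tau> * ?G + \<tau>\<^sup>2 / 2 * ?N)
          + \<tau> * (d (?p s) + (1 - \<tau>) * ?G + (1 - \<tau>)\<^sup>2 / 2 * ?N)
          \<le> (1 - \<tau>) * d (?x s) + \<tau> * d (?y s)"
        using dx dy \<tau> by (intro add_mono mult_left_mono) auto
      moreover have "(1 - \<tau>) * (P - \<tau> * G + \<tau>\<^sup>2 / 2 * N) + \<tau> * (P + (1 - \<tau>) * G + (1 - \<tau>)\<^sup>2 / 2 * N)
          = P + \<tau> * (1 - \<tau>) / 2 * N" for P G N :: real
        by (simp add: field_simps power2_eq_square)
      moreover have "norm v = (1 - s) * norm (y - x)"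
        using s by (simp add: v_def)
      ultimately show ?case by simp
    qed
  qed simp
qed

text \<open>
  Dividing the chord inequality by \<open>\<tau>\<close> and letting \<open>\<tau>\<close> tend to zero recovers the gradient form of strong
  convexity, now at every point of \<open>Q\<close>.
\<close>
lemma bregman_dist_ge:
  fixes d :: "'a::real_normed_vector \<Rightarrow> real"
  assumes d: "prox_function Q d d'" and int: "interior Q \<noteq> {}" and x: "x \<in> Q" and y: "y \<in> Q"
  shows "1 / 2 * (norm (y - x))\<^sup>2 \<le> bregman_dist d d' x y"
proof -
  have Q: "convex Q"
    using d by (auto simp: prox_function_def convex_on_def)
  have dd: "(d has_derivative blinfun_apply (d' x)) (at x within Q)"
    using d x by (simp add: prox_function_def)
  have "blinfun_apply (d' x) (y - x) \<le> d y - d x - (1 - 0) / 2 * (norm (y - x))\<^sup>2"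
  proof (rule tendsto_le)
    show "((\<lambda>\<tau>. (d (x + \<tau> *\<^sub>R (y - x)) - d x) / \<tau>) \<longlongrightarrow> blinfun_apply (d' x) (y - x)) (at_right 0)"
      by (rule directional_derivative[OF Q x y dd])
    show "((\<lambda>\<tau>. d y - d x - (1 - \<tau>) / 2 * (norm (y - x))\<^sup>2)
        \<longlongrightarrow> d y - d x - (1 - 0) / 2 * (norm (y - x))\<^sup>2) (at_right 0)"
      by (intro tendsto_intros) auto
    have "eventually (\<lambda>\<tau>. \<tau> \<in> {0<..<1}) (at_right (0::real))"
      by (rule eventually_at_right_real) simp
    then show "eventually (\<lambda>\<tau>. (d (x + \<tau> *\<^sub>R (y - x)) - d x) / \<tau>
        \<le> d y - d x - (1 - \<tau>) / 2 * (norm (y - x))\<^sup>2) (at_right (0::real))"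
    proof eventually_elim
      case (elim \<tau>)
      then have \<tau>: "0 < \<tau>" "\<tau> < 1" by auto
      have "d (x + \<tau> *\<^sub>R (y - x)) - d x \<le> (d y - d x - (1 - \<tau>) / 2 * (norm (y - x))\<^sup>2) * \<tau>"
        using prox_function_chord_gap[OF d int x y \<tau>] by (simp add: algebra_simps)
      then show ?case using \<tau> by (simp add: pos_divide_le_eq)
    qed
  qed simp
  then show ?thesis by (simp add: bregman_dist_def)
qed

lemma bregman_dist_nonneg:
  assumes "prox_function Q d d'" "interior Q \<noteq> {}" "x \<in> Q" "y \<in> Q"
  shows "0 \<le> bregman_dist d d' x y"
  using bregman_dist_ge[OF assms] zero_le_power2[of "norm (y - x)"] by linarith

text \<open>
  First-order optimality along the segment from \<open>z\<close> to \<open>y\<close> says that minus \<open>M\<close> times the gradient of \<open>d\<close>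
  acts as a subgradient of \<open>\<psi>\<close> at \<open>z\<close>; the remainder of \<open>d\<close> beyond its linear part is the Bregman distance.
\<close>
lemma bregman_minimizer_growth:
  fixes d \<psi> :: "'a::real_normed_vector \<Rightarrow> real"
  assumes \<psi>: "convex_on Q \<psi>"
    and d: "(d has_derivative blinfun_apply (d' z)) (at z within Q)"
    and M: "M > 0" and z: "z \<in> Q" and y: "y \<in> Q"
    and min: "\<And>w. w \<in> Q \<Longrightarrow> \<psi> z + M * d z \<le> \<psi> w + M * d w"
  shows "\<psi> z + M * d z + M * bregman_dist d d' z y \<le> \<psi> y + M * d y"
proof -
  have Q: "convex Q" using \<psi> by (simp add: convex_on_def)
  have "(\<psi> z - \<psi> y) / M \<le> blinfun_apply (d' z) (y - z)"
  proof (rule tendsto_lowerbound[OF directional_derivative[OF Q z y d]])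
    have "eventually (\<lambda>\<tau>. \<tau> \<in> {0<..<1}) (at_right (0::real))"
      by (rule eventually_at_right_real) simp
    then show "eventually (\<lambda>\<tau>. (\<psi> z - \<psi> y) / M \<le> (d (z + \<tau> *\<^sub>R (y - z)) - d z) / \<tau>) (at_right (0::real))"
    proof eventually_elim
      case (elim \<tau>)
      then have \<tau>: "0 < \<tau>" "\<tau> < 1" by auto
      have p: "z + \<tau> *\<^sub>R (y - z) = (1 - \<tau>) *\<^sub>R z + \<tau> *\<^sub>R y"
        by (simp add: algebra_simps)
      have "\<psi> (z + \<tau> *\<^sub>R (y - z)) \<le> (1 - \<tau>) * \<psi> z + \<tau> * \<psi> y"
        unfolding p using convex_onD[OF \<psi>, of \<tau> z y] \<tau> z y by simp
      moreover have "\<psi> z + M * d z \<le> \<psi> (z + \<tau> *\<^sub>R (y - z)) + M * d (z + \<tau> *\<^sub>R (y - z))"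
        by (rule min) (use Q z y \<tau> in \<open>auto simp: p convex_alt\<close>)
      ultimately have "\<tau> * (\<psi> z - \<psi> y) \<le> M * (d (z + \<tau> *\<^sub>R (y - z)) - d z)"
        by (simp add: algebra_simps)
      then show ?case
        using M \<tau> by (simp add: divide_simps mult.commute)
    qed
  qed simp
  then have "\<psi> z - \<psi> y \<le> M * blinfun_apply (d' z) (y - z)"
    using M by (simp add: divide_simps mult.commute)
  then show ?thesis
    by (simp add: bregman_dist_def algebra_simps)
qed

section \<open>One Bregman step\<close>

text \<open>
  As a function of \<open>w\<close> the Bregman model is an affine function plus \<open>\<Psi> w + M * d w\<close>, so the growth in
  \<open>bregman_minimizer_growth\<close> applies to its minimizer.
\<close>
lemma bregman_model_three_point:
  fixes f \<Psi> d :: "'a::real_normed_vector \<Rightarrow> real"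
  assumes \<Psi>: "convex_on Q \<Psi>" and d: "prox_function Q d d'" and M: "M > 0"
    and min: "is_arg_min (bregman_model f f' \<Psi> d d' M x) (\<lambda>y. y \<in> Q) z" and y: "y \<in> Q"
  shows "bregman_model f f' \<Psi> d d' M x z + M * bregman_dist d d' z y
      \<le> bregman_model f f' \<Psi> d d' M x y"
proof -
  define g where "g = f' x - M *\<^sub>R d' x"
  define c where "c = f x - blinfun_apply (f' x) x + M * (blinfun_apply (d' x) x - d x)"
  define \<psi> where "\<psi> = (\<lambda>w. (blinfun_apply g w + c) + \<Psi> w)"
  have model: "bregman_model f f' \<Psi> d d' M x w = \<psi> w + M * d w" for w
    by (simp add: bregman_model_def bregman_dist_def \<psi>_def g_def c_def blinfun.diff_left
        blinfun.diff_right blinfun.scaleR_left algebra_simps)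
  have Q: "convex Q" using \<Psi> by (simp add: convex_on_def)
  have "convex_on Q (\<lambda>w. blinfun_apply g w + c)"
  proof (rule convex_onI)
    fix t :: real and u v :: 'a
    show "blinfun_apply g ((1 - t) *\<^sub>R u + t *\<^sub>R v) + c
        \<le> (1 - t) * (blinfun_apply g u + c) + t * (blinfun_apply g v + c)"
      by (simp add: blinfun.add_right blinfun.scaleR_right blinfun.diff_right algebra_simps)
  qed (rule Q)
  then have "convex_on Q \<psi>"
    unfolding \<psi>_def using \<Psi> by (rule convex_on_add)
  moreover have z: "z \<in> Q" and le: "\<And>w. w \<in> Q \<Longrightarrow> \<psi> z + M * d z \<le> \<psi> w + M * d w"
    using min by (auto simp: is_arg_min_linorder model)
  moreover have "(d has_derivative blinfun_apply (d' z)) (at z within Q)"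
    using d z by (simp add: prox_function_def)
  ultimately show ?thesis
    unfolding model using M y by (intro bregman_minimizer_growth[of Q])
qed

lemma composite_descent:
  fixes f \<Psi> d :: "'a::real_normed_vector \<Rightarrow> real"
  assumes \<Psi>: "convex_on Q \<Psi>" and d: "prox_function Q d d'" and int: "interior Q \<noteq> {}"
    and M: "M > 0" and x: "x \<in> Q" and y: "y \<in> Q"
    and min: "is_arg_min (bregman_model f f' \<Psi> d d' M x) (\<lambda>y. y \<in> Q) z"
    and accept: "f z \<le> f x + blinfun_apply (f' x) (z - x) + M / 2 * (norm (z - x))\<^sup>2 + \<epsilon> / 2"
  shows "f z + \<Psi> z \<le> f x + blinfun_apply (f' x) (y - x) + \<Psi> y + \<epsilon> / 2
      + M * (bregman_dist d d' x y - bregman_dist d d' z y)"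
proof -
  have z: "z \<in> Q" using min by (simp add: is_arg_min_def)
  have "M / 2 * (norm (z - x))\<^sup>2 \<le> M * bregman_dist d d' x z"
    using mult_left_mono[OF bregman_dist_ge[OF d int x z], of M] M by simp
  then have "f z + \<Psi> z \<le> bregman_model f f' \<Psi> d d' M x z + \<epsilon> / 2"
    using accept by (simp add: bregman_model_def)
  also have "\<dots> \<le> bregman_model f f' \<Psi> d d' M x y - M * bregman_dist d d' z y + \<epsilon> / 2"
    using bregman_model_three_point[OF \<Psi> d M min y] by simp
  finally show ?thesis by (simp add: bregman_model_def algebra_simps)
qed

text \<open>
  The test with index \<open>j\<close> has quadratic coefficient \<open>2 ^ j * L / 2\<close>, so it passes once \<open>2 ^ j * L \<ge> \<gamma>\<close>; this makes
  the least index meaningful. If that index is positive, the test before it failed, hence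
  \<open>2 ^ (i - 1) * L < \<gamma>\<close>; if it is zero, \<open>L / 2 \<le> L \<le> \<gamma>\<close>.
\<close>
lemma line_search_accepted:
  fixes f \<Psi> d :: "'a::real_normed_vector \<Rightarrow> real"
    and f' d' :: "'a \<Rightarrow> 'a \<Rightarrow>\<^sub>L real" and Q :: "'a set"
  assumes L: "0 < L" "L \<le> \<gamma>"
    and bound: "\<And>M y. \<gamma> \<le> M \<Longrightarrow>
      f y \<le> f x + blinfun_apply (f' x) (y - x) + M / 2 * (norm (y - x))\<^sup>2 + \<epsilon> / 2"
  defines "i \<equiv> line_search_index f f' Q \<Psi> d d' \<epsilon> L x"
  defines "z \<equiv> bregman_map f f' Q \<Psi> d d' (2 ^ i * L) x"
  shows "f z \<le> f x + blinfun_apply (f' x) (z - x) + (2 ^ i * L) / 2 * (norm (z - x))\<^sup>2 + \<epsilon> / 2"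
    and "2 powi (int i - 1) * L \<le> \<gamma>"
proof -
  define P where "P j \<longleftrightarrow> (let x' = bregman_map f f' Q \<Psi> d d' (2 ^ j * L) x in
      f x' \<le> f x + blinfun_apply (f' x) (x' - x)
             + 2 powi (int j - 1) * L * (norm (x' - x))\<^sup>2 + \<epsilon> / 2)" for j
  have half: "2 powi (int j - 1) = (2::real) ^ j / 2" for j
    by (simp add: power_int_diff)
  have ok: "P j" if "\<gamma> \<le> 2 ^ j * L" for j
    using bound[OF that] by (simp add: P_def Let_def half)
  have i: "i = (LEAST j. P j)"
    unfolding i_def line_search_index_def P_def ..
  obtain j where "\<gamma> / L < 2 ^ j"
    using real_arch_pow[of 2 "\<gamma> / L"] by auto
  then have "P j" using L by (intro ok) (simp add: field_simps)
  then have "P i" unfolding i by (rule LeastI)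
  then show "f z \<le> f x + blinfun_apply (f' x) (z - x) + (2 ^ i * L) / 2 * (norm (z - x))\<^sup>2 + \<epsilon> / 2"
    by (simp add: P_def Let_def half z_def)
  show "2 powi (int i - 1) * L \<le> \<gamma>"
  proof (cases i)
    case 0
    then show ?thesis using L by (simp add: half)
  next
    case (Suc j)
    then have "\<not> P j" using not_less_Least[of j P] i by simp
    then have "2 ^ j * L < \<gamma>" using ok[of j] by linarith
    then show ?thesis using Suc by (simp add: half)
  qed
qed

section \<open>Convergence of the universal primal gradient method\<close>

text \<open>
  Dividing each step by its weight \<open>L (Suc i)\<close> makes the potential \<open>r\<close> telescope with the constant factor
  \<open>2\<close>. In the application \<open>r i\<close> is the Bregman distance from \<open>x i\<close> to a fixed \<open>y\<close>.
\<close>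
lemma weighted_average_bound:
  fixes A B C L r :: "nat \<Rightarrow> real"
  assumes L: "\<And>k. L k > 0"
    and step: "\<And>i. A i \<le> B i + c + 2 * L (Suc i) * (r i - r (Suc i))" and r: "\<And>i. 0 \<le> r i"
  shows "1 / pgm_weight L k * (\<Sum>i=0..k. 1 / L (Suc i) * A i)
      \<le> 1 / pgm_weight L k * (\<Sum>i=0..k. 1 / L (Suc i) * B i) + c + 2 / pgm_weight L k * r 0"
proof -
  let ?S = "pgm_weight L k"
  have S: "?S > 0"
    unfolding pgm_weight_def using L by (intro sum_pos) auto
  have "1 / L (Suc i) * A i \<le> 1 / L (Suc i) * B i + c * (1 / L (Suc i)) + 2 * (r i - r (Suc i))" for i
    using mult_left_mono[OF step[of i], of "1 / L (Suc i)"] L[of "Suc i"]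
    by (simp add: field_simps)
  then have "(\<Sum>i=0..k. 1 / L (Suc i) * A i)
      \<le> (\<Sum>i=0..k. 1 / L (Suc i) * B i + c * (1 / L (Suc i)) + 2 * (r i - r (Suc i)))"
    by (intro sum_mono)
  also have "\<dots> = (\<Sum>i=0..k. 1 / L (Suc i) * B i) + c * ?S + 2 * (\<Sum>i=0..k. r i - r (Suc i))"
    by (simp add: sum.distrib sum_distrib_left pgm_weight_def)
  also have "(\<Sum>i=0..k. r i - r (Suc i)) = r 0 - r (Suc k)"
    by (induction k) auto
  also have "(\<Sum>i=0..k. 1 / L (Suc i) * B i) + c * ?S + 2 * (r 0 - r (Suc k))
      \<le> (\<Sum>i=0..k. 1 / L (Suc i) * B i) + c * ?S + 2 * r 0"
    using r[of "Suc k"] by simp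
  finally show ?thesis
    using S by (simp add: field_simps)
qed

theorem theorem4:
  fixes f \<Psi> d :: "'a::real_normed_vector \<Rightarrow> real"
    and f' d' :: "'a \<Rightarrow> 'a \<Rightarrow>\<^sub>L real"
    and Q :: "'a set"
    and x0 xstar :: 'a
    and x :: "nat \<Rightarrow> 'a"
    and L :: "nat \<Rightarrow> real"
    and L0 \<epsilon> :: real
  assumes finite_dim: "\<exists>B::'a set. finite B \<and> span B = UNIV"
    and f_convex: "convex_on UNIV f"
    and f_not_affine: "\<not> affine_fun f"
    and f_subgradient: "\<And>z. f' z \<in> subdifferential f z"
    and f_regular: "regular_curvature f"
    and \<Psi>_closed_convex: "closed_convex_fun Q \<Psi>"
    and Q_interior: "interior Q \<noteq> {}"
    and d_prox: "prox_function Q d d'"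
    and x0_min: "is_arg_min d (\<lambda>z. z \<in> Q) x0"
    and d_x0: "d x0 = 0"
    and bregman_attained: "\<And>M z. M > 0 \<Longrightarrow> z \<in> Q \<Longrightarrow>
          \<exists>y. is_arg_min (bregman_model f f' \<Psi> d d' M z) (\<lambda>y. y \<in> Q) y"
    and xstar_opt: "is_arg_min (\<lambda>z. f z + \<Psi> z) (\<lambda>z. z \<in> Q) xstar"
    and eps_pos: "\<epsilon> > 0"
    and L0_pos: "0 < L0"
    and L0_le: "L0 \<le> gamma_gauge f \<epsilon>"
    and run: "pgm_run f f' Q \<Psi> d d' \<epsilon> x0 L0 x L"
  shows "(\<forall>k. L k \<le> gamma_gauge f \<epsilon>) \<and>
         (\<forall>k. \<forall>y\<in>Q.
            pgm_average f \<Psi> x L k \<le>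
              1 / pgm_weight L k *
                (\<Sum>i=0..k. 1 / L (Suc i) * (f (x i) + blinfun_apply (f' (x i)) (y - x i)))
              + \<Psi> y + \<epsilon> / 2 + 2 / pgm_weight L k * bregman_dist d d' x0 y) \<and>
         (\<forall>k. pgm_average f \<Psi> x L k - (f xstar + \<Psi> xstar) \<le>
              \<epsilon> / 2 + 2 / (real k + 1) * gamma_gauge f \<epsilon> * bregman_dist d d' x0 xstar)"
proof -
  let ?\<gamma> = "gamma_gauge f \<epsilon>"
  interpret finite_curvature f f'
    by unfold_locales (use f_convex f_subgradient f_regular in \<open>auto simp: regular_curvature_def\<close>)
  have \<Psi>: "convex_on Q \<Psi>"
    using \<Psi>_closed_convex by (simp add: closed_convex_fun_def)
  have x0: "x0 \<in> Q" and xstar: "xstar \<in> Q"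
    using x0_min xstar_opt by (auto simp: is_arg_min_def)
  have \<gamma>: "?\<gamma> > 0"
    by (rule gamma_gauge_pos[OF f_not_affine eps_pos])
  define ii where "ii k = line_search_index f f' Q \<Psi> d d' \<epsilon> (L k) (x k)" for k
  have start: "x 0 = x0" "L 0 = L0"
    and next_x: "x (Suc k) = bregman_map f f' Q \<Psi> d d' (2 ^ ii k * L k) (x k)"
    and next_L: "L (Suc k) = 2 powi (int (ii k) - 1) * L k" for k
    using run by (auto simp: pgm_run_def ii_def Let_def)
  have map_min: "is_arg_min (bregman_model f f' \<Psi> d d' M z) (\<lambda>y. y \<in> Q) (bregman_map f f' Q \<Psi> d d' M z)"
    if "M > 0" "z \<in> Q" for M z
    unfolding bregman_map_def arg_min_def using bregman_attained[OF that] by (rule someI_ex)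
  \<comment> \<open>The line search needs \<open>L k \<le> \<gamma>\<close> to preserve this bound, so the three facts are proved together.\<close>
  have inv: "x k \<in> Q \<and> 0 < L k \<and> L k \<le> ?\<gamma>" for k
  proof (induction k)
    case 0
    then show ?case using start x0 L0_pos L0_le by simp
  next
    case (Suc k)
    have "x (Suc k) \<in> Q"
      using map_min[of "2 ^ ii k * L k" "x k"] Suc by (simp add: next_x is_arg_min_def)
    moreover have "0 < L (Suc k)"
      using Suc by (simp add: next_L)
    moreover have "L (Suc k) \<le> ?\<gamma>"
      unfolding next_L ii_def using Suc
      by (intro line_search_accepted(2) inexact_quadratic_upper_bound f_not_affine eps_pos) auto
    ultimately show ?case by simp
  qed
  have descent: "f (x (Suc k)) + \<Psi> (x (Suc k)) \<le> (f (x k) + blinfun_apply (f' (x k)) (y - x k))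
      + (\<Psi> y + \<epsilon> / 2)
      + 2 * L (Suc k) * (bregman_dist d d' (x k) y - bregman_dist d d' (x (Suc k)) y)"
    if y: "y \<in> Q" for k y
  proof -
    have M: "2 ^ ii k * L k > 0" "2 ^ ii k * L k = 2 * L (Suc k)"
      using inv[of k] by (auto simp: next_L power_int_diff)
    have "f (x (Suc k)) \<le> f (x k) + blinfun_apply (f' (x k)) (x (Suc k) - x k)
        + (2 ^ ii k * L k) / 2 * (norm (x (Suc k) - x k))\<^sup>2 + \<epsilon> / 2"
      unfolding next_x ii_def using inv[of k]
      by (intro line_search_accepted(1) inexact_quadratic_upper_bound f_not_affine eps_pos) auto
    moreover have "is_arg_min (bregman_model f f' \<Psi> d d' (2 ^ ii k * L k) (x k)) (\<lambda>y. y \<in> Q) (x (Suc k))"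
      unfolding next_x using map_min[OF M(1)] inv[of k] by blast
    ultimately show ?thesis
      using composite_descent[OF \<Psi> d_prox Q_interior M(1) _ y] inv[of k] M(2) by fastforce
  qed
  have avg: "pgm_average f \<Psi> x L k \<le>
      1 / pgm_weight L k * (\<Sum>i=0..k. 1 / L (Suc i) * (f (x i) + blinfun_apply (f' (x i)) (y - x i)))
      + (\<Psi> y + \<epsilon> / 2) + 2 / pgm_weight L k * bregman_dist d d' x0 y" if y: "y \<in> Q" for k y
    unfolding pgm_average_def start(1)[symmetric]
    by (rule weighted_average_bound)
      (use descent[OF y] inv bregman_dist_nonneg[OF d_prox Q_interior _ y] in auto)
  have rate: "pgm_average f \<Psi> x L k - (f xstar + \<Psi> xstar)
      \<le> \<epsilon> / 2 + 2 / (real k + 1) * ?\<gamma> * bregman_dist d d' x0 xstar" for k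
  proof -
    let ?S = "pgm_weight L k"
    have "(real k + 1) / ?\<gamma> = (\<Sum>i=0..k. 1 / ?\<gamma>)" by simp
    also have "\<dots> \<le> ?S"
      unfolding pgm_weight_def using inv \<gamma> by (intro sum_mono divide_left_mono) auto
    finally have S_ge: "(real k + 1) / ?\<gamma> \<le> ?S" .
    have S: "?S > 0"
      by (rule less_le_trans[OF _ S_ge]) (use \<gamma> in auto)
    have "f (x i) + blinfun_apply (f' (x i)) (xstar - x i) \<le> f xstar" for i
      using f_subgradient[of "x i"] by (auto simp: subdifferential_def)
    then have "(\<Sum>i=0..k. 1 / L (Suc i) * (f (x i) + blinfun_apply (f' (x i)) (xstar - x i)))
        \<le> (\<Sum>i=0..k. 1 / L (Suc i) * f xstar)"
      using inv by (intro sum_mono mult_left_mono) (auto intro: less_imp_le)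
    also have "\<dots> = ?S * f xstar"
      by (simp add: pgm_weight_def sum_distrib_right)
    finally have lower: "1 / ?S
        * (\<Sum>i=0..k. 1 / L (Suc i) * (f (x i) + blinfun_apply (f' (x i)) (xstar - x i))) \<le> f xstar"
      using S by (simp add: field_simps)
    have "2 / ?S \<le> 2 / ((real k + 1) / ?\<gamma>)"
      using S_ge S \<gamma> by (intro divide_left_mono) auto
    then have "2 / ?S * bregman_dist d d' x0 xstar
        \<le> 2 / (real k + 1) * ?\<gamma> * bregman_dist d d' x0 xstar"
      using bregman_dist_nonneg[OF d_prox Q_interior x0 xstar] by (intro mult_right_mono) auto
    then show ?thesis
      using avg[OF xstar, of k] lower by linarith
  qed
  show ?thesis
    using inv avg rate by (auto simp: add.assoc)
qed

end
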